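(* For every integer $r\ge 1$, $$\sum_{\substack{\mathbf{k}\in\mathcal{A}_r\\ \|\mathbf{k}\|\le x}}1 = rx+O_r(1).$$ That is, for each integer $r\ge 1$ there is a constant $M_r$, depending only on $r$, such that for all real $x\ge 1$ the number of admissible chains of valences $\mathbf{k}$ of length $r$ with $\|\mathbf{k}\|\le x$ differs from $rx$ by at most $M_r$ in absolute value.
   Context: An $r$-tuple $\mathbf{k}=(k_1,\dots,k_r)$ of positive integers is called admissible (an admissible chain of valences of length $r$) if there exist an integer $Q\ge 1$ and integers $q_0,q_1,\dots,q_{r+1}$ with $1\le q_0,q_1,\dots,q_{r+1}\le Q$ such that: $\gcd(q_j,q_{j+1})=1$ for $0\le j\le r$; $q_j+q_{j+1}>Q$ for $0\le j\le r$; and $k_jq_j=q_{j-1}+q_{j+1}$ for $1\le j\le r$. The set of all admissible $r$-tuples is denoted $\mathcal{A}_r$. The norm $\|\mathbf{k}\|$ of a chain $\mathbf{k}$ is its largest component. *)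

theory Defs
  imports Complex_Main
begin

text \<open>A tuple \<open>(k\<^sub>1, \<dots>, k\<^sub>r)\<close> is a list \<open>ks\<close> of length \<open>r\<close>, so that \<open>k\<^sub>j\<close> is \<open>ks ! (j - 1)\<close>. Only the
  values \<open>q 0, \<dots>, q (r + 1)\<close> of the function \<open>q\<close> are constrained.\<close>

definition admissible :: "nat list \<Rightarrow> bool" where
  "admissible ks \<longleftrightarrow>
     (\<forall>k\<in>set ks. 1 \<le> k) \<and>
     (\<exists>(Q::nat) (q :: nat \<Rightarrow> nat).
        1 \<le> Q \<and>
        (\<forall>j\<in>{0..length ks + 1}. 1 \<le> q j \<and> q j \<le> Q) \<and>
        (\<forall>j\<in>{0..length ks}. gcd (q j) (q (j + 1)) = 1) \<and>
        (\<forall>j\<in>{0..length ks}. q j + q (j + 1) > Q) \<and>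
        (\<forall>j\<in>{1..length ks}. ks ! (j - 1) * q j = q (j - 1) + q (j + 1)))"

definition admissible_chains :: "nat \<Rightarrow> nat list set" where
  "admissible_chains r = {ks. length ks = r \<and> admissible ks}"

definition chain_norm :: "nat list \<Rightarrow> nat" where
  "chain_norm ks = Max (set ks)"

end

theory Submission
  imports Defs
begin

text \<open>
  A large valence \<open>k\<close> determines the whole chain around it. From \<open>k q\<^sub>p = q\<^sub>p\<^sub>-\<^sub>1 + q\<^sub>p\<^sub>+\<^sub>1 \<le> 2 Q\<close> the
  denominator \<open>a = q\<^sub>p\<close> is small compared with \<open>Q\<close>, so the condition \<open>q\<^sub>j + q\<^sub>j\<^sub>+\<^sub>1 > Q\<close> puts both
  neighbours of \<open>a\<close> within \<open>a\<close> of \<open>Q\<close>. Moving away from \<open>p\<close> on either side, the valence is then the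
  only multiple that keeps the next denominator in the window \<open>(Q - q\<^sub>j, Q]\<close>: it is \<open>1\<close> once and \<open>2\<close>
  from then on, while the denominators fall in steps of \<open>a\<close>. As long as the number of steps is small
  compared with \<open>k\<close>, nothing else can happen (\<open>valences_beside_small_denominator\<close>). So a chain
  of length \<open>r\<close> and norm \<open>k \<ge> 4 r + 6\<close> is \<open>2, \<dots>, 2, 1, k, 1, 2, \<dots>, 2\<close>, with \<open>k\<close> in one of \<open>r\<close>
  places.

  Each of these \<open>r\<close> lists does occur (\<open>spike_admissible\<close>): take the denominator \<open>1\<close> at the peak
  and \<open>Q = k / 2\<close> beside it if \<open>k\<close> is even, and \<open>2\<close> and \<open>Q = k\<close> if \<open>k\<close> is odd. Hence every
  norm \<open>k \<ge> 4 r + 6\<close> is attained exactly \<open>r\<close> times, and the finitely many chains of smaller norm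
  go into the constant.
\<close>

section \<open>Chains with one large valence\<close>

fun spike_value :: "nat \<Rightarrow> nat \<Rightarrow> nat" where
  "spike_value k 0 = k"
| "spike_value k (Suc 0) = 1"
| "spike_value k (Suc (Suc d)) = 2"

text \<open>The sum of two truncated differences is the distance of \<open>i\<close> from \<open>p\<close>.\<close>

definition spike :: "nat \<Rightarrow> nat \<Rightarrow> nat \<Rightarrow> nat list" where
  "spike r k p = map (\<lambda>i. spike_value k ((i - p) + (p - i))) [0..<r]"

lemma length_spike [simp]: "length (spike r k p) = r"
  by (simp add: spike_def)

lemma nth_spike: "i < r \<Longrightarrow> spike r k p ! i = spike_value k ((i - p) + (p - i))"
  by (simp add: spike_def)

lemma nth_spike_peak: "p < r \<Longrightarrow> spike r k p ! p = k"
  by (simp add: nth_spike)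

lemma spike_value_off_peak: "0 < d \<Longrightarrow> 1 \<le> spike_value k d \<and> spike_value k d \<le> 2"
  by (cases "(k, d)" rule: spike_value.cases) auto

lemma spike_value_bounds:
  assumes "2 \<le> k"
  shows "1 \<le> spike_value k d" and "spike_value k d \<le> k"
  using assms spike_value_off_peak[of d k] by (cases "d = 0"; simp)+

lemma inj_on_spike:
  assumes "3 \<le> k"
  shows "inj_on (spike r k) {..<r}"
proof (rule inj_onI)
  fix p p' assume "p \<in> {..<r}" "p' \<in> {..<r}" and eq: "spike r k p = spike r k p'"
  then have "spike_value k ((p - p') + (p' - p)) = k"
    by (metis lessThan_iff nth_spike nth_spike_peak)
  then have "\<not> 0 < (p - p') + (p' - p)"
    using spike_value_off_peak[of "(p - p') + (p' - p)" k] assms by linarith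
  then show "p = p'" by simp
qed

lemma chain_norm_spike:
  assumes "p < r" and "2 \<le> k"
  shows "chain_norm (spike r k p) = k"
  unfolding chain_norm_def
proof (rule Max_eqI)
  show "k \<in> set (spike r k p)"
    using assms by (metis length_spike nth_mem nth_spike_peak)
  show "y \<le> k" if "y \<in> set (spike r k p)" for y
    using that spike_value_bounds(2)[OF assms(2)] by (auto simp: spike_def)
qed simp

section \<open>A large valence forces the rest of the chain\<close>

text \<open>One side of a peak, read outwards, so that \<open>f 0\<close> is the small denominator. The upper bound
  \<open>Q\<close> excludes valences that are too large and the condition on sums those that are too small. The
  factor \<open>4 n + 6\<close> is what keeps \<open>3\<close> excluded for \<open>n\<close> steps, since the denominators have by then
  fallen from about \<open>Q\<close> by at most \<open>n\<close> times \<open>f 0\<close>. The equations for \<open>f\<close> are carried along because the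
  bounds on the next valence rest on them.\<close>

lemma valences_beside_small_denominator:
  fixes f c :: "nat \<Rightarrow> nat"
  assumes le: "\<And>i. i \<le> n + 1 \<Longrightarrow> f i \<le> Q"
    and gap: "\<And>i. i \<le> n \<Longrightarrow> Q < f i + f (i + 1)"
    and rec: "\<And>i. 1 \<le> i \<Longrightarrow> i \<le> n \<Longrightarrow> c i * f i = f (i - 1) + f (i + 1)"
    and small: "(4 * n + 6) * f 0 \<le> 2 * Q"
    and i: "1 \<le> i" "i \<le> n"
  shows "c i = spike_value k i \<and> f i = f (i + 1) + f 0 \<and> f (i + 1) + i * f 0 = f 1"
  using i
proof (induction i rule: dec_induct)
  case base
  have near: "Q < f 0 + f 1" using gap[of 0] by simp
  have eq: "c 1 * f 1 = f 0 + f 2" using rec[of 1] base by (simp add: numeral_2_eq_2)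
  have "6 * f 0 \<le> 2 * Q" using small by (simp add: add_mult_distrib)
  have "f 2 \<le> Q" using le[of 2] base by simp
  have "c 1 < 2"
  proof (rule ccontr)
    assume "\<not> c 1 < 2"
    then have "2 * f 1 \<le> c 1 * f 1" by (intro mult_right_mono) auto
    then show False using eq near \<open>6 * f 0 \<le> 2 * Q\<close> \<open>f 2 \<le> Q\<close> by linarith
  qed
  moreover have "c 1 \<noteq> 0"
  proof
    assume "c 1 = 0"
    then have "f 2 = 0" using eq by auto
    then show False using gap[of 1] le[of 1] base by (simp add: numeral_2_eq_2)
  qed
  ultimately have "c 1 = 1" by linarith
  then show ?case using eq by (simp add: numeral_2_eq_2)
next
  case (step i)
  let ?a = "f 0" and ?m = "f (i + 1)"
  have IH: "f i = ?m + ?a" "?m + i * ?a = f 1" using step by auto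
  have eq: "c (i + 1) * ?m = ?m + ?a + f (i + 2)" using rec[of "i + 1"] step IH by simp
  have near: "Q < ?a + f 1" using gap[of 0] by simp
  have next_gap: "Q < ?m + f (i + 2)" using gap[of "i + 1"] step by simp
  have "?m \<le> Q" "f (i + 2) \<le> Q" using le[of "i + 1"] le[of "i + 2"] step by simp_all
  have small': "4 * (i * ?a) + 6 * ?a \<le> 2 * Q"
  proof -
    have "i * ?a \<le> n * ?a" using step by (intro mult_right_mono) auto
    moreover have "4 * (n * ?a) + 6 * ?a \<le> 2 * Q" using small by (simp add: add_mult_distrib)
    ultimately show ?thesis by linarith
  qed
  have "c (i + 1) < 3"
  proof (rule ccontr)
    assume "\<not> c (i + 1) < 3"
    then have "3 * ?m \<le> c (i + 1) * ?m" by (intro mult_right_mono) auto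
    then show False using eq near IH small' \<open>f (i + 2) \<le> Q\<close> by linarith
  qed
  moreover have "\<not> c (i + 1) \<le> 1"
  proof
    assume "c (i + 1) \<le> 1"
    then have "c (i + 1) * ?m \<le> 1 * ?m" by (intro mult_right_mono) auto
    then show False using eq next_gap \<open>?m \<le> Q\<close> by linarith
  qed
  ultimately have two: "c (i + 1) = 2" by linarith
  then have "?m = f (i + 2) + ?a" using eq by simp
  then show ?case using two IH step.hyps by (cases i) auto
qed

text \<open>The defining conditions are symmetric under reversal, so the two sides of the large entry
  are both instances of the one-sided lemma.\<close>

lemma admissible_large_entry_imp_spike:
  assumes adm: "admissible ks" and p: "p < length ks"
    and large: "4 * length ks + 6 \<le> ks ! p"
  shows "ks = spike (length ks) (ks ! p) p"
proof -
  let ?r = "length ks" and ?k = "ks ! p"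
  from adm obtain Q q where
    "\<forall>j\<in>{0..?r + 1}. 1 \<le> q j \<and> q j \<le> Q"
    "\<forall>j\<in>{0..?r}. q j + q (j + 1) > Q"
    "\<forall>j\<in>{1..?r}. ks ! (j - 1) * q j = q (j - 1) + q (j + 1)"
    unfolding admissible_def by blast
  then have le: "\<And>j. j \<le> ?r + 1 \<Longrightarrow> q j \<le> Q"
    and gap: "\<And>j. j \<le> ?r \<Longrightarrow> Q < q j + q (j + 1)"
    and rec: "\<And>j. 1 \<le> j \<Longrightarrow> j \<le> ?r \<Longrightarrow> ks ! (j - 1) * q j = q (j - 1) + q (j + 1)"
    by auto
  have "?k * q (p + 1) = q p + q (p + 2)"
    using rec[of "p + 1"] p by simp
  also have "\<dots> \<le> 2 * Q" using le[of p] le[of "p + 2"] p by simp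
  finally have peak: "?k * q (p + 1) \<le> 2 * Q" .
  have small: "(4 * n + 6) * q (p + 1) \<le> 2 * Q" if "n \<le> ?r" for n
  proof -
    have "(4 * n + 6) * q (p + 1) \<le> ?k * q (p + 1)"
      using that large by (intro mult_right_mono) auto
    then show ?thesis using peak by linarith
  qed
  show ?thesis
  proof (rule nth_equalityI)
    fix i assume i: "i < length ks"
    consider "i = p" | "p < i" | "i < p" by linarith
    then show "ks ! i = spike ?r ?k p ! i"
    proof cases
      case 1
      then show ?thesis using p by (simp add: nth_spike_peak)
    next
      case 2
      have "ks ! (p + (i - p)) = spike_value ?k (i - p)"
      proof (rule valences_beside_small_denominator
              [where f = "\<lambda>t. q (p + 1 + t)" and c = "\<lambda>t. ks ! (p + t)" and n = "?r - p - 1"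
                and Q = Q, THEN conjunct1])
        show "q (p + 1 + t) \<le> Q" if "t \<le> ?r - p - 1 + 1" for t
          using le[of "p + 1 + t"] that p by simp
        show "Q < q (p + 1 + t) + q (p + 1 + (t + 1))" if "t \<le> ?r - p - 1" for t
          using gap[of "p + 1 + t"] that p by simp
        show "ks ! (p + t) * q (p + 1 + t) = q (p + 1 + (t - 1)) + q (p + 1 + (t + 1))"
          if "1 \<le> t" "t \<le> ?r - p - 1" for t
          using rec[of "p + 1 + t"] that p by simp
        show "(4 * (?r - p - 1) + 6) * q (p + 1 + 0) \<le> 2 * Q"
          using small[of "?r - p - 1"] by simp
      qed (use 2 i in auto)
      then show ?thesis using 2 i by (simp add: nth_spike)
    next
      case 3
      have "ks ! (p - (p - i)) = spike_value ?k (p - i)"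
      proof (rule valences_beside_small_denominator
              [where f = "\<lambda>t. q (p + 1 - t)" and c = "\<lambda>t. ks ! (p - t)" and n = p
                and Q = Q, THEN conjunct1])
        show "q (p + 1 - t) \<le> Q" for t
          using le[of "p + 1 - t"] p by simp
        show "Q < q (p + 1 - t) + q (p + 1 - (t + 1))" if "t \<le> p" for t
          using gap[of "p - t"] that p by (simp add: Suc_diff_le add.commute)
        show "ks ! (p - t) * q (p + 1 - t) = q (p + 1 - (t - 1)) + q (p + 1 - (t + 1))"
          if "1 \<le> t" "t \<le> p" for t
        proof -
          define j where "j = p + 1 - t"
          then have "p + 1 - t = j" "p + 1 - (t - 1) = j + 1" "p + 1 - (t + 1) = j - 1"
            "p - t = j - 1" "1 \<le> j" "j \<le> ?r"
            using that p by auto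
          then show ?thesis using rec[of j] by (simp only:)
        qed
        show "(4 * p + 6) * q (p + 1 - 0) \<le> 2 * Q"
          using small[of p] p by simp
      qed (use 3 in auto)
      then show ?thesis using 3 i by (simp add: nth_spike)
    qed
  qed simp
qed

section \<open>Every spike occurs\<close>

text \<open>The denominator at distance \<open>t\<close> from a peak with denominator \<open>s\<close>, when the two beside the
  peak are equal to \<open>Q\<close>.\<close>

fun spike_denominator :: "nat \<Rightarrow> nat \<Rightarrow> nat \<Rightarrow> nat" where
  "spike_denominator Q s 0 = s"
| "spike_denominator Q s (Suc t) = Q - t * s"

text \<open>On either side of the peak the denominators stay above \<open>Q / 2\<close>, because \<open>r s\<close> is small compared
  with \<open>Q\<close>; this gives the condition on sums there. Neighbours on the same side differ by \<open>s\<close> and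
  are congruent to \<open>Q\<close> modulo \<open>s\<close>, so they are coprime because \<open>s\<close> and \<open>Q\<close> are.\<close>

lemma spike_admissible:
  assumes large: "4 * r + 6 \<le> k" and p: "p < r"
  shows "admissible (spike r k p)"
proof -
  \<comment> \<open>The equation at the peak is \<open>k s = 2 Q\<close>, and \<open>s\<close> has to be coprime to \<open>Q\<close>.\<close>
  define s where "s = (if even k then 1 else 2 :: nat)"
  define Q where "Q = (if even k then k div 2 else k)"
  have ks: "k * s = 2 * Q" and cop: "coprime s Q" and s: "1 \<le> s"
    unfolding s_def Q_def by auto
  let ?g = "spike_denominator Q s"
  have bound: "2 * (t * s) + 3 * s \<le> Q" if "t \<le> r" for t
  proof -
    have "(4 * t + 6) * s \<le> k * s" using large that by (intro mult_right_mono) auto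
    then show ?thesis using ks by (simp add: add_mult_distrib)
  qed
  have g_range: "1 \<le> ?g t \<and> ?g t \<le> Q" if "t \<le> r + 1" for t
    using bound[of "t - 1"] that s by (cases t) auto
  have g_cop: "coprime (?g t) (?g (Suc t))" if "t \<le> r" for t
  proof (cases t)
    case 0
    then show ?thesis using cop by simp
  next
    case (Suc u)
    have "coprime s (Q - Suc u * s)"
    proof -
      have "coprime s ((Q - Suc u * s) + Suc u * s)"
        using bound[of t] that Suc cop by simp
      then show ?thesis
        using gcd_add_mult[of s "Suc u" "Q - Suc u * s"]
        by (simp only: coprime_iff_gcd_eq_1 add.commute)
    qed
    moreover have "Q - u * s = s + (Q - Suc u * s)"
      using bound[of t] that Suc by simp
    ultimately show ?thesis using Suc
      by (simp add: coprime_iff_gcd_eq_1 del: mult_Suc)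
  qed
  have g_gap: "Q < ?g t + ?g (Suc t)" if "t \<le> r" for t
    using bound[of t] that s by (cases t) auto
  have g_rec: "spike_value k t * ?g t = ?g (t - 1) + ?g (Suc t)" if "1 \<le> t" "t \<le> r" for t
    using bound[of t] that by (cases "(k, t)" rule: spike_value.cases) auto
  \<comment> \<open>List indices start at \<open>0\<close>, so the entry at \<open>p\<close> is the valence of the denominator \<open>p + 1\<close>.\<close>
  define q where "q j = ?g ((j - (p + 1)) + (p + 1 - j))" for j
  have up: "q (p + 1 + t) = ?g t" for t unfolding q_def by simp
  have down: "q (p + 1 - t) = ?g t" if "t \<le> p + 1" for t unfolding q_def using that by simp
  have steps: "coprime (q j) (q (j + 1)) \<and> Q < q j + q (j + 1)" if "j \<le> r" for j
  proof (cases "p < j")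
    case True
    then obtain t where "j = p + 1 + t" using less_iff_Suc_add by auto
    then show ?thesis using up[of t] up[of "Suc t"] g_cop[of t] g_gap[of t] that by simp
  next
    case False
    then have "j = p + 1 - Suc (p - j)" "j + 1 = p + 1 - (p - j)" by auto
    then have "q j = ?g (Suc (p - j))" "q (j + 1) = ?g (p - j)"
      using down[of "Suc (p - j)"] down[of "p - j"] False by auto
    then show ?thesis
      using g_cop[of "p - j"] g_gap[of "p - j"] p by (simp add: coprime_commute add.commute)
  qed
  have rec: "spike r k p ! (j - 1) * q j = q (j - 1) + q (j + 1)" if "1 \<le> j" "j \<le> r" for j
  proof -
    consider "j = p + 1" | t where "1 \<le> t" "j = p + 1 + t" | t where "1 \<le> t" "t \<le> p" "j = p + 1 - t"
    proof -
      have "j = p + 1 \<or> (\<exists>t\<ge>1. j = p + 1 + t) \<or> (\<exists>t\<ge>1. t \<le> p \<and> j = p + 1 - t)"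
        using \<open>1 \<le> j\<close> by presburger
      then show thesis using that by blast
    qed
    then show ?thesis
    proof cases
      case 1
      then show ?thesis
        using up[of 0] up[of 1] down[of 1] ks p by (simp add: nth_spike_peak)
    next
      case 2
      then show ?thesis
        using up[of "t - 1"] up[of t] up[of "Suc t"] g_rec[of t] that by (simp add: nth_spike)
    next
      case 3
      then have "j - 1 = p + 1 - Suc t" "j + 1 = p + 1 - (t - 1)" by auto
      then have "q (j - 1) = ?g (Suc t)" "q j = ?g t" "q (j + 1) = ?g (t - 1)"
        using 3 down[of "t - 1"] down[of t] down[of "Suc t"] by auto
      moreover have "spike r k p ! (j - 1) = spike_value k t"
        using 3 that p by (simp add: nth_spike)
      ultimately show ?thesis using g_rec[of t] 3 p by simp
    qed
  qed
  show ?thesis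
    unfolding admissible_def length_spike
  proof (intro conjI exI[of _ Q] exI[of _ q])
    show "\<forall>v\<in>set (spike r k p). 1 \<le> v"
      using spike_value_bounds(1)[of k] large by (auto simp: spike_def)
    show "1 \<le> Q" using g_range[of 0] by simp
    show "\<forall>j\<in>{0..r + 1}. 1 \<le> q j \<and> q j \<le> Q"
      using g_range p unfolding q_def by auto
    show "\<forall>j\<in>{0..r}. gcd (q j) (q (j + 1)) = 1"
      using steps by (auto simp: coprime_iff_gcd_eq_1)
    show "\<forall>j\<in>{0..r}. Q < q j + q (j + 1)" using steps by auto
    show "\<forall>j\<in>{1..r}. spike r k p ! (j - 1) * q j = q (j - 1) + q (j + 1)" using rec by auto
  qed
qed

section \<open>Counting\<close>

lemma chains_of_large_norm_eq_spikes:
  assumes "r \<ge> 1" and large: "4 * r + 6 \<le> k"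
  shows "{ks \<in> admissible_chains r. chain_norm ks = k} = spike r k ` {..<r}"
proof (intro equalityI subsetI)
  fix ks assume "ks \<in> {ks \<in> admissible_chains r. chain_norm ks = k}"
  then have len: "length ks = r" and adm: "admissible ks" and norm: "Max (set ks) = k"
    by (auto simp: admissible_chains_def chain_norm_def)
  have "k \<in> set ks" using Max_in[of "set ks"] norm len assms(1) by fastforce
  then obtain p where "p < r" "ks ! p = k" using len by (auto simp: in_set_conv_nth)
  then show "ks \<in> spike r k ` {..<r}"
    using admissible_large_entry_imp_spike[OF adm, of p] len large by auto
next
  fix ks assume "ks \<in> spike r k ` {..<r}"
  then show "ks \<in> {ks \<in> admissible_chains r. chain_norm ks = k}"
    using spike_admissible[OF large] chain_norm_spike large by (auto simp: admissible_chains_def)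
qed

lemma finite_chains_norm_le: "finite {ks \<in> admissible_chains r. chain_norm ks \<le> n}"
proof (rule finite_subset)
  show "{ks \<in> admissible_chains r. chain_norm ks \<le> n} \<subseteq> {ks. set ks \<subseteq> {..n} \<and> length ks = r}"
  proof (clarsimp simp: admissible_chains_def chain_norm_def)
    fix ks :: "nat list" and v assume "Max (set ks) \<le> n" "v \<in> set ks"
    then show "v \<le> n" by (meson Max_ge List.finite_set le_trans)
  qed
qed (simp add: finite_lists_length_eq)

lemma card_chains_norm_le_Suc:
  assumes "r \<ge> 1" and "4 * r + 6 \<le> Suc n"
  shows "card {ks \<in> admissible_chains r. chain_norm ks \<le> Suc n}
           = card {ks \<in> admissible_chains r. chain_norm ks \<le> n} + r"
proof -
  let ?E = "{ks \<in> admissible_chains r. chain_norm ks = Suc n}"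
  have "{ks \<in> admissible_chains r. chain_norm ks \<le> Suc n}
      = {ks \<in> admissible_chains r. chain_norm ks \<le> n} \<union> ?E"
    by auto
  moreover have "card ?E = r"
    using chains_of_large_norm_eq_spikes[OF assms] card_image[OF inj_on_spike[of "Suc n" r]] assms
    by simp
  moreover have "finite ?E"
    by (rule finite_subset[OF _ finite_chains_norm_le[of r "Suc n"]]) auto
  moreover have "{ks \<in> admissible_chains r. chain_norm ks \<le> n} \<inter> ?E = {}"
    by auto
  ultimately show ?thesis
    by (simp only: card_Un_disjoint[OF finite_chains_norm_le])
qed

lemma card_chains_norm_le_large:
  assumes "r \<ge> 1" and "4 * r + 6 \<le> n"
  shows "card {ks \<in> admissible_chains r. chain_norm ks \<le> n}
           = card {ks \<in> admissible_chains r. chain_norm ks \<le> 4 * r + 6} + r * (n - (4 * r + 6))"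
  using assms(2)
proof (induction n rule: dec_induct)
  case (step n)
  then show ?case using card_chains_norm_le_Suc[OF assms(1), of n] by (simp add: Suc_diff_le)
qed simp

theorem theorem1:
  fixes r :: nat
  assumes "r \<ge> 1"
  shows "\<exists>M::real. \<forall>x::real. x \<ge> 1 \<longrightarrow>
           \<bar>real (card {ks \<in> admissible_chains r. real (chain_norm ks) \<le> x}) - real r * x\<bar> \<le> M"
proof (intro exI allI impI)
  fix x :: real assume x: "x \<ge> 1"
  define N where "N n = card {ks \<in> admissible_chains r. chain_norm ks \<le> n}" for n
  define K where "K = 4 * r + 6"
  define n where "n = nat \<lfloor>x\<rfloor>"
  have n: "real n \<le> x" "x < real n + 1" using x unfolding n_def by linarith+
  have "(real m \<le> x) = (m \<le> n)" for m
    unfolding n_def using x by (simp add: le_nat_floor le_nat_iff le_floor_iff)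
  then have count: "card {ks \<in> admissible_chains r. real (chain_norm ks) \<le> x} = N n"
    unfolding N_def by simp
  have rx: "real r * n \<le> r * x" "r * x \<le> real r * n + r"
    using n mult_left_mono[of "real n" x r] mult_left_mono[of x "real n + 1" r]
    by (simp_all add: algebra_simps)
  have "\<bar>real (N n) - r * x\<bar> \<le> real (N K) + real r * K + r"
  proof (cases "K \<le> n")
    case True
    then have "N n = N K + r * (n - K)"
      using card_chains_norm_le_large[OF assms, of n] unfolding N_def K_def by simp
    then have "real (N n) = N K + real r * n - real r * K"
      using True by (simp add: of_nat_diff right_diff_distrib)
    moreover have "0 \<le> real r * real K" by simp
    ultimately show ?thesis using rx by linarith
  next
    case False
    then have "N n \<le> N K"
      unfolding N_def by (intro card_mono finite_chains_norm_le) auto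
    moreover have "real r * n \<le> real r * K" using False by (intro mult_left_mono) auto
    moreover have "0 \<le> real r * real n" by simp
    ultimately show ?thesis using rx by linarith
  qed
  then show "\<bar>real (card {ks \<in> admissible_chains r. real (chain_norm ks) \<le> x}) - real r * x\<bar>
      \<le> real (N K) + real r * K + r"
    using count by simp
qed

end
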